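(* Let $R$ be a commutative ring with identity. Then the following conditions are equivalent: (1) Every ideal of $R$ is $P$-flat (as an $R$-module). (2) Every principal ideal of $R$ is $P$-flat (as an $R$-module). (3) $R$ is a $PF$-ring, that is, every principal ideal of $R$ is flat (as an $R$-module). (4) For any $(s,x)\in R^{2}$ such that $sx=0$, there exists $\alpha\in(0:s)$ such that $x=\alpha x$.
   Context: All rings are commutative with identity and all modules are unitary. For $s\in R$, $(0:s)=\{r\in R : rs=0\}$. An $R$-module $M$ is called $P$-flat if, for any $(s,x)\in R\times M$ such that $sx=0$, one has $x\in(0:s)M$. A ring $R$ is called a $PF$-ring if every principal ideal of $R$ is flat. *)

theory Defs
  imports "HOL-Algebra.Algebra" "HOL-Algebra.Free_Abelian_Groups"
begin

text \<open>
  The fields \<open>mult\<close> and \<open>one\<close> are part of the library's module record but are not used by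
  the locale \<^locale>\<open>module\<close>.
\<close>

definition ideal_module :: "('a, 'm) ring_scheme \<Rightarrow> 'a set \<Rightarrow> ('a, 'a) module" where
  "ideal_module R I =
     \<lparr>carrier = I, monoid.mult = (\<otimes>\<^bsub>R\<^esub>), one = \<one>\<^bsub>R\<^esub>, ring.zero = \<zero>\<^bsub>R\<^esub>, ring.add = (\<oplus>\<^bsub>R\<^esub>),
      smult = (\<otimes>\<^bsub>R\<^esub>)\<rparr>"

lemma (in cring) module_ideal_module:
  assumes "ideal I R"
  shows "module R (ideal_module R I)"
proof -
  interpret I: ideal I R by fact
  show ?thesis
  proof (rule moduleI)
    show "abelian_group (ideal_module R I)"
    proof (rule abelian_groupI)
      fix x assume x: "x \<in> carrier (ideal_module R I)"
      then show "\<exists>y\<in>carrier (ideal_module R I).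
          y \<oplus>\<^bsub>ideal_module R I\<^esub> x = \<zero>\<^bsub>ideal_module R I\<^esub>"
        by (auto simp: ideal_module_def intro!: bexI[of _ "\<ominus> x"] l_neg)
    qed (auto simp: ideal_module_def I.Icarr a_ac)
  qed (auto simp: ideal_module_def is_cring I.Icarr I.I_l_closed l_distr r_distr m_assoc)
qed

definition annihilator :: "('a, 'm) ring_scheme \<Rightarrow> 'a \<Rightarrow> 'a set" where
  "annihilator R s = {r \<in> carrier R. r \<otimes>\<^bsub>R\<^esub> s = \<zero>\<^bsub>R\<^esub>}"

text \<open>
  \<open>I M\<close> for an ideal \<open>I\<close>: the additive subgroup generated by the products, that is, the set
  of finite sums of products; it is automatically a submodule.
\<close>

definition ideal_smult :: "'a set \<Rightarrow> ('a, 'b, 'n) module_scheme \<Rightarrow> 'b set" where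
  "ideal_smult I M = generate (add_monoid M) {a \<odot>\<^bsub>M\<^esub> y | a y. a \<in> I \<and> y \<in> carrier M}"

definition P_flat :: "('a, 'm) ring_scheme \<Rightarrow> ('a, 'b, 'n) module_scheme \<Rightarrow> bool" where
  "P_flat R M \<longleftrightarrow> module R M \<and>
     (\<forall>s\<in>carrier R. \<forall>x\<in>carrier M.
        s \<odot>\<^bsub>M\<^esub> x = \<zero>\<^bsub>M\<^esub> \<longrightarrow> x \<in> ideal_smult (annihilator R s) M)"

definition module_hom ::
    "('a, 'm) ring_scheme \<Rightarrow> ('a, 'b, 'n) module_scheme \<Rightarrow> ('a, 'c, 'k) module_scheme
      \<Rightarrow> ('b \<Rightarrow> 'c) set" where
  "module_hom R M N =
     {f \<in> hom (add_monoid M) (add_monoid N).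
        \<forall>r\<in>carrier R. \<forall>x\<in>carrier M. f (r \<odot>\<^bsub>M\<^esub> x) = r \<odot>\<^bsub>N\<^esub> f x}"

text \<open>
  The underlying abelian group of \<open>M \<otimes>\<^sub>R N\<close>: the free abelian group on
  \<open>M \<times> N\<close> modulo the subgroup generated by the bilinearity relations; the class of
  \<open>frag_of (x, y)\<close> is \<open>x \<otimes> y\<close>. Only this group is needed below, since flatness
  concerns injectivity of the induced maps.
\<close>

definition tensor_relators ::
    "('a, 'm) ring_scheme \<Rightarrow> ('a, 'b, 'n) module_scheme \<Rightarrow> ('a, 'c, 'k) module_scheme
      \<Rightarrow> (('b \<times> 'c) \<Rightarrow>\<^sub>0 int) set" where
  "tensor_relators R M N =
     {frag_of (x \<oplus>\<^bsub>M\<^esub> x', y) - frag_of (x, y) - frag_of (x', y) | x x' y.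
        x \<in> carrier M \<and> x' \<in> carrier M \<and> y \<in> carrier N} \<union>
     {frag_of (x, y \<oplus>\<^bsub>N\<^esub> y') - frag_of (x, y) - frag_of (x, y') | x y y'.
        x \<in> carrier M \<and> y \<in> carrier N \<and> y' \<in> carrier N} \<union>
     {frag_of (r \<odot>\<^bsub>M\<^esub> x, y) - frag_of (x, r \<odot>\<^bsub>N\<^esub> y) | r x y.
        r \<in> carrier R \<and> x \<in> carrier M \<and> y \<in> carrier N}"

definition tensor_kernel ::
    "('a, 'm) ring_scheme \<Rightarrow> ('a, 'b, 'n) module_scheme \<Rightarrow> ('a, 'c, 'k) module_scheme
      \<Rightarrow> (('b \<times> 'c) \<Rightarrow>\<^sub>0 int) set" where
  "tensor_kernel R M N =
     generate (free_Abelian_group (carrier M \<times> carrier N)) (tensor_relators R M N)"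

definition tensor_product ::
    "('a, 'm) ring_scheme \<Rightarrow> ('a, 'b, 'n) module_scheme \<Rightarrow> ('a, 'c, 'k) module_scheme
      \<Rightarrow> (('b \<times> 'c) \<Rightarrow>\<^sub>0 int) set monoid" where
  "tensor_product R M N =
     free_Abelian_group (carrier M \<times> carrier N) Mod tensor_kernel R M N"

text \<open>
  \<open>id\<^sub>M \<otimes> f : M \<otimes>\<^sub>R N \<rightarrow> M \<otimes>\<^sub>R N'\<close>, sending \<open>x \<otimes> y\<close> to \<open>x \<otimes> f y\<close>. A coset \<open>C\<close> is sent
  to the coset of the image of any representative; for a homomorphism \<open>f\<close> this does not depend
  on the representative, so the union is over a single coset.
\<close>

definition tensor_map ::
    "('a, 'm) ring_scheme \<Rightarrow> ('a, 'b, 'n) module_scheme \<Rightarrow> ('a, 'd, 'l) module_scheme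
      \<Rightarrow> ('c \<Rightarrow> 'd) \<Rightarrow> (('b \<times> 'c) \<Rightarrow>\<^sub>0 int) set \<Rightarrow> (('b \<times> 'd) \<Rightarrow>\<^sub>0 int) set" where
  "tensor_map R M N' f C =
     (\<Union>c\<in>C. tensor_kernel R M N' #>\<^bsub>free_Abelian_group (carrier M \<times> carrier N')\<^esub>
        frag_extend (\<lambda>(x, y). frag_of (x, f y)) c)"

text \<open>
  \<open>M\<close> is flat if \<open>M \<otimes>\<^sub>R _\<close> preserves injectivity of homomorphisms. A formula cannot
  quantify over types, so the modules \<open>N\<close>, \<open>N'\<close> tested have elements in a type \<open>'u\<close>, which
  plays the role of a universe and is made explicit as an argument. As soon as \<open>'u\<close> has at
  least as many elements as \<open>R\<close>, every inclusion of an ideal into \<open>R\<close> has a copy in \<open>'u\<close>, and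
  the notion is then independent of \<open>'u\<close> by the ideal criterion for flatness.
\<close>

definition flat_module ::
    "'u itself \<Rightarrow> ('a, 'm) ring_scheme \<Rightarrow> ('a, 'b, 'n) module_scheme \<Rightarrow> bool" where
  "flat_module U R M \<longleftrightarrow> module R M \<and>
     (\<forall>(N :: ('a, 'u) module) (N' :: ('a, 'u) module) f.
        module R N \<and> module R N' \<and> f \<in> module_hom R N N' \<and> inj_on f (carrier N) \<longrightarrow>
        inj_on (tensor_map R M N' f) (carrier (tensor_product R M N)))"

definition PF_ring :: "'u itself \<Rightarrow> ('a, 'm) ring_scheme \<Rightarrow> bool" where
  "PF_ring U R \<longleftrightarrow> cring R \<and>
     (\<forall>I. principalideal I R \<longrightarrow> flat_module U R (ideal_module R I))"

end

theory Submission
  imports Defs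
begin

text \<open>
  Every condition of the theorem says the same thing about annihilators: each ideal
  \<open>(0 : s)\<close> is pure, meaning that each of its elements \<open>x\<close> has a local unit \<open>\<alpha> \<in> (0 : s)\<close>
  with \<open>x = \<alpha> x\<close>. For P-flatness this is close to the definition: in a cyclic module \<open>R n\<close> the
  submodule \<open>A (R n)\<close> consists of the multiples \<open>a n\<close> with \<open>a \<in> A\<close>
  (\<open>ideal_smult_cyclic\<close>), so \<open>x \<in> (0 : s) (R x)\<close> already reads \<open>x = \<alpha> x\<close>.

  For flatness everything rests on the isomorphism \<open>R x \<otimes> N \<cong> N / (0 : x) N\<close>, used in the
  elementary form that \<open>x \<otimes> n = 0\<close> holds exactly when \<open>n \<in> (0 : x) N\<close>
  (\<open>tensor_generator_zero_iff\<close>), and on the fact that every element of \<open>R x \<otimes> N\<close> is of the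
  form \<open>x \<otimes> n\<close> (\<open>tensor_eq_generator_tensor\<close>).

  If \<open>R x\<close> is flat and \<open>s x = 0\<close>, consider the inclusion \<open>R s \<rightarrow> R\<close>. In \<open>R x \<otimes> R\<close> the
  tensor \<open>x \<otimes> s\<close> vanishes, because \<open>s = s \<cdot> 1 \<in> (0 : x) R\<close>. By flatness it vanishes in
  \<open>R x \<otimes> R s\<close>, hence \<open>s \<in> (0 : x) (R s)\<close>, and the cyclic case gives \<open>s = a s\<close> with
  \<open>a \<in> (0 : x)\<close>. The inclusion is moved into the universe \<open>'u\<close> along an injection
  \<open>R \<rightarrow> 'u\<close>.

  Conversely, let annihilators be pure and let \<open>f : N \<rightarrow> N'\<close> be injective with
  \<open>x \<otimes> f n = 0\<close>. Then \<open>f n = \<Sum> a\<^sub>i y\<^sub>i\<close> with \<open>a\<^sub>i x = 0\<close>. Purity of \<open>(0 : a\<^sub>i)\<close>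
  gives \<open>\<alpha>\<^sub>i\<close> with \<open>\<alpha>\<^sub>i a\<^sub>i = 0\<close> and \<open>\<alpha>\<^sub>i x = x\<close>, and the product \<open>\<alpha>\<close> of
  the \<open>\<alpha>\<^sub>i\<close> kills \<open>f n\<close> while fixing \<open>x\<close>. Injectivity gives \<open>\<alpha> n = 0\<close>, so
  \<open>x \<otimes> n = \<alpha> x \<otimes> n = x \<otimes> \<alpha> n = 0\<close>.
\<close>

section \<open>Pure ideals and annihilators\<close>

definition pure_ideal :: "('a, 'm) ring_scheme \<Rightarrow> 'a set \<Rightarrow> bool" where
  "pure_ideal R A \<longleftrightarrow> (\<forall>x\<in>A. \<exists>\<alpha>\<in>A. x = \<alpha> \<otimes>\<^bsub>R\<^esub> x)"

lemma (in cring) ideal_annihilator: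
  assumes "s \<in> carrier R"
  shows "ideal (annihilator R s) R"
proof (rule idealI)
  show "subgroup (annihilator R s) (add_monoid R)"
    by (rule add.subgroupI) (use assms in \<open>auto simp: annihilator_def l_distr l_minus\<close>)
next
  fix a x assume "a \<in> annihilator R s" "x \<in> carrier R"
  then show "x \<otimes> a \<in> annihilator R s"
    using assms by (simp add: annihilator_def m_assoc)
  then show "a \<otimes> x \<in> annihilator R s"
    using \<open>a \<in> annihilator R s\<close> \<open>x \<in> carrier R\<close> by (simp add: annihilator_def m_comm)
qed (rule ring_axioms)

lemma (in cring) pure_annihilators_iff:
  "(\<forall>s\<in>carrier R. pure_ideal R (annihilator R s)) \<longleftrightarrow>
   (\<forall>s\<in>carrier R. \<forall>x\<in>carrier R. s \<otimes> x = \<zero> \<longrightarrow> (\<exists>\<alpha>\<in>annihilator R s. x = \<alpha> \<otimes> x))"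
  by (auto simp: pure_ideal_def annihilator_def m_comm)

section \<open>The submodule generated by an ideal\<close>

context module
begin

lemma ideal_smult_generators_closed:
  "A \<subseteq> carrier R \<Longrightarrow> {a \<odot>\<^bsub>M\<^esub> y | a y. a \<in> A \<and> y \<in> carrier M} \<subseteq> carrier M"
  by auto

lemma subgroup_ideal_smult:
  "A \<subseteq> carrier R \<Longrightarrow> subgroup (ideal_smult A M) (add_monoid M)"
  unfolding ideal_smult_def
  by (rule M.add.generate_is_subgroup) (simp add: ideal_smult_generators_closed)

lemma smult_in_ideal_smult:
  "\<lbrakk>a \<in> A; y \<in> carrier M\<rbrakk> \<Longrightarrow> a \<odot>\<^bsub>M\<^esub> y \<in> ideal_smult A M"
  unfolding ideal_smult_def by (rule generate.incl) auto

lemma ideal_smult_minimal: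
  assumes "subgroup H (add_monoid M)"
    and "\<And>a y. \<lbrakk>a \<in> A; y \<in> carrier M\<rbrakk> \<Longrightarrow> a \<odot>\<^bsub>M\<^esub> y \<in> H"
  shows "ideal_smult A M \<subseteq> H"
  unfolding ideal_smult_def
  by (rule M.add.generate_subgroup_incl) (use assms in auto)

text \<open>
  Since \<open>a (r n) = (a r) n\<close> with \<open>a r \<in> A\<close>, the generators of \<open>A M\<close> are multiples of the single
  element \<open>n\<close> by elements of \<open>A\<close>, and such multiples are closed under addition.
\<close>

lemma ideal_smult_cyclic:
  assumes "ideal A R" and n: "n \<in> carrier M"
    and cyclic: "carrier M = {r \<odot>\<^bsub>M\<^esub> n | r. r \<in> carrier R}"
    and m: "m \<in> ideal_smult A M"
  obtains a where "a \<in> A" "m = a \<odot>\<^bsub>M\<^esub> n"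
proof -
  interpret A: ideal A R by fact
  have "ideal_smult A M \<subseteq> {a \<odot>\<^bsub>M\<^esub> n | a. a \<in> A}"
  proof (rule ideal_smult_minimal)
    show "subgroup {a \<odot>\<^bsub>M\<^esub> n | a. a \<in> A} (add_monoid M)"
    proof (rule M.add.subgroupI)
      show "{a \<odot>\<^bsub>M\<^esub> n | a. a \<in> A} \<noteq> {}"
        using additive_subgroup.zero_closed[OF A.is_additive_subgroup] by blast
    next
      fix u assume "u \<in> {a \<odot>\<^bsub>M\<^esub> n | a. a \<in> A}"
      then obtain a where "a \<in> A" "u = a \<odot>\<^bsub>M\<^esub> n" by blast
      then show "\<ominus>\<^bsub>M\<^esub> u \<in> {a \<odot>\<^bsub>M\<^esub> n | a. a \<in> A}"
        using smult_l_minus[of a n] n A.a_inv_closed[of a] A.Icarr[of a]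
        by (metis (mono_tags, lifting) mem_Collect_eq)
    next
      fix u v assume "u \<in> {a \<odot>\<^bsub>M\<^esub> n | a. a \<in> A}" "v \<in> {a \<odot>\<^bsub>M\<^esub> n | a. a \<in> A}"
      then obtain a b where "a \<in> A" "u = a \<odot>\<^bsub>M\<^esub> n" "b \<in> A" "v = b \<odot>\<^bsub>M\<^esub> n" by blast
      then show "u \<oplus>\<^bsub>M\<^esub> v \<in> {a \<odot>\<^bsub>M\<^esub> n | a. a \<in> A}"
        using smult_l_distr[of a b n] n A.Icarr
          additive_subgroup.a_closed[OF A.is_additive_subgroup, of a b]
        by (metis (mono_tags, lifting) mem_Collect_eq)
    qed (use n A.Icarr in auto)
  next
    fix a y assume a: "a \<in> A" and "y \<in> carrier M"
    then obtain r where "r \<in> carrier R" "y = r \<odot>\<^bsub>M\<^esub> n"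
      using cyclic by blast
    then have "a \<odot>\<^bsub>M\<^esub> y = (a \<otimes> r) \<odot>\<^bsub>M\<^esub> n" "a \<otimes> r \<in> A"
      using a n A.Icarr A.I_r_closed by (auto simp: smult_assoc1)
    then show "a \<odot>\<^bsub>M\<^esub> y \<in> {a \<odot>\<^bsub>M\<^esub> n | a. a \<in> A}" by blast
  qed
  then show thesis using m that by blast
qed

end

lemma carrier_ideal_module [simp]: "carrier (ideal_module R I) = I"
  and smult_ideal_module [simp]: "smult (ideal_module R I) = monoid.mult R"
  and zero_ideal_module [simp]: "ring.zero (ideal_module R I) = ring.zero R"
  and add_ideal_module [simp]: "ring.add (ideal_module R I) = ring.add R"
  by (simp_all add: ideal_module_def)

section \<open>P-flatness\<close>

text \<open>
  The local unit does not depend on the ideal: \<open>x = \<alpha> x\<close> exhibits \<open>x\<close> as an element of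
  \<open>(0 : s) I\<close> for every ideal \<open>I\<close> containing \<open>x\<close>.
\<close>

lemma (in cring) P_flat_ideal_if_pure_annihilators:
  assumes I: "ideal I R" and pure: "\<And>s. s \<in> carrier R \<Longrightarrow> pure_ideal R (annihilator R s)"
  shows "P_flat R (ideal_module R I)"
  unfolding P_flat_def
proof (intro conjI ballI impI)
  interpret I: ideal I R by fact
  show m: "module R (ideal_module R I)"
    by (rule module_ideal_module[OF I])
  interpret M: module R "ideal_module R I" by (rule m)
  fix s x
  assume s: "s \<in> carrier R" and x: "x \<in> carrier (ideal_module R I)"
    and "s \<odot>\<^bsub>ideal_module R I\<^esub> x = \<zero>\<^bsub>ideal_module R I\<^esub>"
  then have "x \<in> annihilator R s"
    by (auto simp: annihilator_def m_comm I.Icarr)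
  then obtain \<alpha> where "\<alpha> \<in> annihilator R s" "x = \<alpha> \<otimes> x"
    using pure[OF s] unfolding pure_ideal_def by blast
  then show "x \<in> ideal_smult (annihilator R s) (ideal_module R I)"
    using M.smult_in_ideal_smult[of \<alpha> "annihilator R s" x] x by simp
qed

text \<open>
  P-flatness is applied to \<open>R x\<close>, the smallest ideal in which \<open>x\<close> can be tested; it is cyclic
  with generator \<open>x\<close>.
\<close>

lemma (in cring) pure_annihilator_if_P_flat:
  assumes flat: "\<And>I. principalideal I R \<Longrightarrow> P_flat R (ideal_module R I)" and s: "s \<in> carrier R"
  shows "pure_ideal R (annihilator R s)"
  unfolding pure_ideal_def
proof
  fix x assume xs: "x \<in> annihilator R s"
  then have x: "x \<in> carrier R" and sx: "s \<otimes> x = \<zero>"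
    using s by (auto simp: annihilator_def m_comm)
  interpret M: module R "ideal_module R (PIdl x)"
    by (rule module_ideal_module[OF cgenideal_ideal[OF x]])
  have "x \<in> ideal_smult (annihilator R s) (ideal_module R (PIdl x))"
    using flat[OF cgenideal_is_principalideal[OF x]] s sx cgenideal_self[OF x]
    by (simp add: P_flat_def)
  then show "\<exists>\<alpha>\<in>annihilator R s. x = \<alpha> \<otimes> x"
    by (rule M.ideal_smult_cyclic[where n = x, OF ideal_annihilator[OF s], rotated 2])
      (use cgenideal_self[OF x] in \<open>auto simp: cgenideal_def\<close>)
qed

section \<open>Calculating with tensors\<close>

text \<open>
  Equations between tensors appear as memberships \<open>c - d \<in> T\<close> of formal sums of pairs, where
  \<open>T\<close> is the subgroup of relations. Calculations then stay in the free
  group, and cosets occur only where the induced maps are treated.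
\<close>

locale tensor_factors = left: module R M + right: module R N
  for R :: "('a, 'm) ring_scheme" (structure)
    and M :: "('a, 'b, 'n) module_scheme" and N :: "('a, 'c, 'k) module_scheme"
begin

abbreviation "F \<equiv> free_Abelian_group (carrier M \<times> carrier N)"
abbreviation "T \<equiv> tensor_kernel R M N"

lemma tensor_relators_closed: "tensor_relators R M N \<subseteq> carrier F"
  unfolding tensor_relators_def by (auto dest!: subsetD[OF keys_diff] simp: keys_frag_of)

lemma subgroup_tensor_kernel: "subgroup T F"
  unfolding tensor_kernel_def
  by (rule group.generate_is_subgroup[OF group_free_Abelian_group tensor_relators_closed])

lemma tensor_kernel_closed: "c \<in> T \<Longrightarrow> Poly_Mapping.keys c \<subseteq> carrier M \<times> carrier N"
  using subsetD[OF subgroup.subset[OF subgroup_tensor_kernel]] by simp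

lemma tensor_kernel_zero: "0 \<in> T"
  using subgroup.one_closed[OF subgroup_tensor_kernel] by simp

lemma tensor_kernel_uminus: "c \<in> T \<Longrightarrow> - c \<in> T"
  using subgroup.m_inv_closed[OF subgroup_tensor_kernel, of c] tensor_kernel_closed[of c] by simp

lemma tensor_kernel_add: "\<lbrakk>c \<in> T; d \<in> T\<rbrakk> \<Longrightarrow> c + d \<in> T"
  using subgroup.m_closed[OF subgroup_tensor_kernel, of c d] by simp

lemma tensor_kernel_diff: "\<lbrakk>c \<in> T; d \<in> T\<rbrakk> \<Longrightarrow> c - d \<in> T"
  using tensor_kernel_add[of c "- d"] tensor_kernel_uminus[of d] by simp

lemma tensor_kernel_eq:
  assumes "c - d \<in> T"
  shows "c \<in> T \<longleftrightarrow> d \<in> T"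
  using assms tensor_kernel_add[of "c - d" d] tensor_kernel_diff[of c "c - d"] by auto

lemma tensor_add_left:
  "\<lbrakk>x \<in> carrier M; x' \<in> carrier M; y \<in> carrier N\<rbrakk> \<Longrightarrow>
    frag_of (x \<oplus>\<^bsub>M\<^esub> x', y) - (frag_of (x, y) + frag_of (x', y)) \<in> T"
  unfolding tensor_kernel_def tensor_relators_def diff_diff_eq[symmetric]
  by (rule generate.incl) blast

lemma tensor_add_right:
  "\<lbrakk>x \<in> carrier M; y \<in> carrier N; y' \<in> carrier N\<rbrakk> \<Longrightarrow>
    frag_of (x, y \<oplus>\<^bsub>N\<^esub> y') - (frag_of (x, y) + frag_of (x, y')) \<in> T"
  unfolding tensor_kernel_def tensor_relators_def diff_diff_eq[symmetric]
  by (rule generate.incl) blast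

lemma tensor_smult:
  "\<lbrakk>r \<in> carrier R; x \<in> carrier M; y \<in> carrier N\<rbrakk> \<Longrightarrow>
    frag_of (r \<odot>\<^bsub>M\<^esub> x, y) - frag_of (x, r \<odot>\<^bsub>N\<^esub> y) \<in> T"
  unfolding tensor_kernel_def tensor_relators_def
  by (rule generate.incl) blast

lemma tensor_zero_right:
  assumes "x \<in> carrier M"
  shows "frag_of (x, \<zero>\<^bsub>N\<^esub>) \<in> T"
  using tensor_kernel_uminus[OF tensor_add_right[of x "\<zero>\<^bsub>N\<^esub>" "\<zero>\<^bsub>N\<^esub>"]] assms by simp

lemma tensor_zero_left:
  assumes "y \<in> carrier N"
  shows "frag_of (\<zero>\<^bsub>M\<^esub>, y) \<in> T"
  using tensor_kernel_uminus[OF tensor_add_left[of "\<zero>\<^bsub>M\<^esub>" "\<zero>\<^bsub>M\<^esub>" y]] assms by simp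

lemma tensor_minus_right:
  assumes "x \<in> carrier M" "y \<in> carrier N"
  shows "frag_of (x, \<ominus>\<^bsub>N\<^esub> y) + frag_of (x, y) \<in> T"
  using tensor_kernel_diff[OF tensor_zero_right[of x] tensor_add_right[of x "\<ominus>\<^bsub>N\<^esub> y" y]] assms
  by (simp add: right.M.l_neg add.commute)

lemma tensor_coset_eq_iff:
  assumes "Poly_Mapping.keys c \<subseteq> carrier M \<times> carrier N"
    and "Poly_Mapping.keys d \<subseteq> carrier M \<times> carrier N"
  shows "T #>\<^bsub>F\<^esub> c = T #>\<^bsub>F\<^esub> d \<longleftrightarrow> c - d \<in> T"
proof -
  have "c \<in> T #>\<^bsub>F\<^esub> d \<longleftrightarrow> c - d \<in> T"
    using subgroup.rcos_module[OF subgroup_tensor_kernel group_free_Abelian_group, of d c] assms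
    by simp
  moreover have "c \<in> T #>\<^bsub>F\<^esub> c"
    using group.rcos_self[OF group_free_Abelian_group _ subgroup_tensor_kernel, of c] assms by simp
  ultimately show ?thesis
    using group.repr_independence[OF group_free_Abelian_group _ _ subgroup_tensor_kernel, of c d]
      assms by auto
qed

text \<open>
  This is the universal property of the tensor product, on the level of the free group. Each
  relation is a difference of two sums on which the extended map agrees by bilinearity, so the
  relations lie in its kernel. The property serves to show that a tensor is nonzero.
\<close>

lemma balanced_map_extends:
  assumes "comm_group G"
    and closed: "\<And>x y. \<lbrakk>x \<in> carrier M; y \<in> carrier N\<rbrakk> \<Longrightarrow> \<phi> x y \<in> carrier G"
    and add_left: "\<And>x x' y. \<lbrakk>x \<in> carrier M; x' \<in> carrier M; y \<in> carrier N\<rbrakk>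
      \<Longrightarrow> \<phi> (x \<oplus>\<^bsub>M\<^esub> x') y = \<phi> x y \<otimes>\<^bsub>G\<^esub> \<phi> x' y"
    and add_right: "\<And>x y y'. \<lbrakk>x \<in> carrier M; y \<in> carrier N; y' \<in> carrier N\<rbrakk>
      \<Longrightarrow> \<phi> x (y \<oplus>\<^bsub>N\<^esub> y') = \<phi> x y \<otimes>\<^bsub>G\<^esub> \<phi> x y'"
    and balanced: "\<And>r x y. \<lbrakk>r \<in> carrier R; x \<in> carrier M; y \<in> carrier N\<rbrakk>
      \<Longrightarrow> \<phi> (r \<odot>\<^bsub>M\<^esub> x) y = \<phi> x (r \<odot>\<^bsub>N\<^esub> y)"
  obtains h where "h \<in> hom F G"
    and "\<And>x y. \<lbrakk>x \<in> carrier M; y \<in> carrier N\<rbrakk> \<Longrightarrow> h (frag_of (x, y)) = \<phi> x y"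
    and "T \<subseteq> kernel F G h"
proof -
  interpret G: comm_group G by fact
  obtain h where h: "h \<in> hom F G"
    and "\<And>p. p \<in> carrier M \<times> carrier N \<Longrightarrow> h (frag_of p) = (\<lambda>(x, y). \<phi> x y) p"
    by (rule G.free_Abelian_group_universal[of "\<lambda>(x, y). \<phi> x y" "carrier M \<times> carrier N"])
      (use closed in auto)
  then have h_of: "h (frag_of (x, y)) = \<phi> x y" if "x \<in> carrier M" "y \<in> carrier N" for x y
    using that by auto
  interpret h: group_hom F G h
    by (simp add: group_hom_def group_hom_axioms_def h G.is_group)
  have h_add: "h (c + d) = h c \<otimes>\<^bsub>G\<^esub> h d" if "c \<in> carrier F" "d \<in> carrier F" for c d
    using h.hom_mult[of c d] that by simp
  have diff: "h (c - d) = \<one>\<^bsub>G\<^esub>" if "c \<in> carrier F" "d \<in> carrier F" "h c = h d" for c d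
  proof -
    have "c - d \<in> carrier F"
      using that(1,2) keys_diff[of c d] by auto
    moreover have "h (c - d) \<otimes>\<^bsub>G\<^esub> h d = h d"
      using h_add[OF \<open>c - d \<in> carrier F\<close> that(2)] that(3) by simp
    ultimately show ?thesis
      using G.r_cancel_one[of "h d" "h (c - d)"] that(2) h.hom_closed by blast
  qed
  have carr: "frag_of (x, y) + frag_of (x', y') \<in> carrier F" if "x \<in> carrier M" "y \<in> carrier N" "x' \<in> carrier M" "y' \<in> carrier N" for x y x' y'
    using that by (auto dest!: subsetD[OF keys_add] simp: keys_frag_of)
  have "T \<subseteq> kernel F G h"
    unfolding tensor_kernel_def
  proof (rule group.generate_subgroup_incl[OF group_free_Abelian_group _ h.subgroup_kernel])
    have "h t = \<one>\<^bsub>G\<^esub>" if "t \<in> tensor_relators R M N" for t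
      using that unfolding tensor_relators_def diff_diff_eq
      by (safe; intro diff)
        (simp_all add: h_of h_add add_left add_right balanced carr del: carrier_free_Abelian_group_iff)
    then show "tensor_relators R M N \<subseteq> kernel F G h"
      using subsetD[OF tensor_relators_closed] unfolding kernel_def by blast
  qed
  then show thesis using that h h_of by blast
qed

end


text \<open>
  From right to left, \<open>x \<otimes> a y = a x \<otimes> y = 0\<close> for \<open>a \<in> (0 : x)\<close>. From left to right,
  \<open>(r x, m) \<mapsto> r m + (0 : x) N\<close> is a well-defined balanced map into \<open>N / (0 : x) N\<close>, since two
  coefficients of the same element of \<open>R x\<close> differ by an element of \<open>(0 : x)\<close>; the induced
  homomorphism sends \<open>x \<otimes> n\<close> to the class of \<open>n\<close>.
\<close>

lemma (in cring) tensor_generator_zero_iff: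
  assumes "module R N" and x: "x \<in> carrier R" and n: "n \<in> carrier N"
  shows "frag_of (x, n) \<in> tensor_kernel R (ideal_module R (PIdl x)) N \<longleftrightarrow>
    n \<in> ideal_smult (annihilator R x) N"
proof -
  let ?M = "ideal_module R (PIdl x)"
  let ?T = "tensor_kernel R ?M N"
  let ?K = "ideal_smult (annihilator R x) N"
  interpret N: module R N by fact
  interpret tensor_factors R ?M N
    by (intro tensor_factors.intro module_ideal_module cgenideal_ideal x \<open>module R N\<close>)
  have xM: "x \<in> carrier ?M"
    by (simp add: cgenideal_self x)
  have ann: "annihilator R x \<subseteq> carrier R"
    by (auto simp: annihilator_def)
  have K: "subgroup ?K (add_monoid N)"
    by (rule N.subgroup_ideal_smult[OF ann])
  have normal_K: "?K \<lhd> add_monoid N"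
    by (rule comm_group.subgroup_imp_normal[OF N.M.a_comm_group K])
  show ?thesis
  proof
    assume "n \<in> ?K"
    moreover have "?K \<subseteq> {m \<in> carrier N. frag_of (x, m) \<in> ?T}"
    proof (rule N.ideal_smult_minimal)
      show "subgroup {m \<in> carrier N. frag_of (x, m) \<in> ?T} (add_monoid N)"
      proof (rule N.M.add.subgroupI)
        show "{m \<in> carrier N. frag_of (x, m) \<in> ?T} \<noteq> {}"
          using tensor_zero_right[OF xM] by blast
      next
        fix m assume "m \<in> {m \<in> carrier N. frag_of (x, m) \<in> ?T}"
        then show "\<ominus>\<^bsub>N\<^esub> m \<in> {m \<in> carrier N. frag_of (x, m) \<in> ?T}"
          using tensor_kernel_diff[OF tensor_minus_right[OF xM, of m], of "frag_of (x, m)"]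
          by simp
      next
        fix m m' assume "m \<in> {m \<in> carrier N. frag_of (x, m) \<in> ?T}"
          "m' \<in> {m \<in> carrier N. frag_of (x, m) \<in> ?T}"
        then show "m \<oplus>\<^bsub>N\<^esub> m' \<in> {m \<in> carrier N. frag_of (x, m) \<in> ?T}"
          using tensor_kernel_eq[OF tensor_add_right[OF xM, of m m']]
            tensor_kernel_add[of "frag_of (x, m)" "frag_of (x, m')"] by simp
      qed auto
    next
      fix a y assume a: "a \<in> annihilator R x" and y: "y \<in> carrier N"
      then have "a \<in> carrier R" "a \<otimes> x = \<zero>"
        by (auto simp: annihilator_def)
      then have "frag_of (\<zero>, y) - frag_of (x, a \<odot>\<^bsub>N\<^esub> y) \<in> ?T"
        using tensor_smult[OF _ xM y, of a] by simp
      then show "a \<odot>\<^bsub>N\<^esub> y \<in> {m \<in> carrier N. frag_of (x, m) \<in> ?T}"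
        using tensor_kernel_eq tensor_zero_left[OF y] y \<open>a \<in> carrier R\<close> by auto
    qed
    ultimately show "frag_of (x, n) \<in> ?T" by blast
  next
    define \<pi> where "\<pi> m = ?K #>\<^bsub>add_monoid N\<^esub> m" for m
    \<comment> \<open>A coefficient of \<open>y\<close> with respect to \<open>x\<close>, unique only modulo \<open>(0 : x)\<close>.\<close>
    define coef where "coef y = (SOME r. r \<in> carrier R \<and> y = r \<otimes> x)" for y
    define \<phi> where "\<phi> y m = \<pi> (coef y \<odot>\<^bsub>N\<^esub> m)" for y m
    have \<pi>_closed: "\<pi> m \<in> carrier (add_monoid N Mod ?K)" if "m \<in> carrier N" for m
      using that by (auto simp: \<pi>_def carrier_FactGroup)
    have \<pi>_add: "\<pi> (m \<oplus>\<^bsub>N\<^esub> m') = \<pi> m \<otimes>\<^bsub>add_monoid N Mod ?K\<^esub> \<pi> m'"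
      if "m \<in> carrier N" "m' \<in> carrier N" for m m'
      using normal.rcos_sum[OF normal_K, of m m'] that by (simp add: \<pi>_def)
    have \<phi>_mult: "\<phi> (r \<otimes> x) m = \<pi> (r \<odot>\<^bsub>N\<^esub> m)" if r: "r \<in> carrier R" and m: "m \<in> carrier N" for r m
    proof -
      let ?c = "coef (r \<otimes> x)"
      have c: "?c \<in> carrier R" "r \<otimes> x = ?c \<otimes> x"
        unfolding atomize_conj coef_def by (rule someI[of _ r]) (simp add: r)
      have "(?c \<ominus> r) \<otimes> x = \<zero>"
        using c r x by (simp add: minus_eq l_distr l_minus r_neg)
      then have "?c \<ominus> r \<in> annihilator R x"
        using c r by (simp add: annihilator_def)
      then have "(?c \<ominus> r) \<odot>\<^bsub>N\<^esub> m \<in> ?K"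
        using N.smult_in_ideal_smult m by blast
      then have "?c \<odot>\<^bsub>N\<^esub> m \<oplus>\<^bsub>N\<^esub> \<ominus>\<^bsub>N\<^esub> (r \<odot>\<^bsub>N\<^esub> m) \<in> ?K"
        using c r m by (simp add: minus_eq N.smult_l_distr N.smult_l_minus)
      then have "?c \<odot>\<^bsub>N\<^esub> m \<in> ?K #>\<^bsub>add_monoid N\<^esub> (r \<odot>\<^bsub>N\<^esub> m)"
        using subgroup.rcos_module[OF K N.M.a_group, of "r \<odot>\<^bsub>N\<^esub> m" "?c \<odot>\<^bsub>N\<^esub> m"] c r m
        by (simp flip: a_inv_def)
      then show ?thesis
        using group.repr_independence[OF N.M.a_group _ _ K] r m by (auto simp: \<phi>_def \<pi>_def)
    qed
    have mult_x: "\<exists>r\<in>carrier R. y = r \<otimes> x" if "y \<in> carrier ?M" for y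
      using that by (auto simp: cgenideal_def)
    obtain h where "h \<in> hom F (add_monoid N Mod ?K)"
      and h: "\<And>y m. \<lbrakk>y \<in> carrier ?M; m \<in> carrier N\<rbrakk> \<Longrightarrow> h (frag_of (y, m)) = \<phi> y m"
      and T: "?T \<subseteq> kernel F (add_monoid N Mod ?K) h"
    proof (rule balanced_map_extends[of "add_monoid N Mod ?K" \<phi>])
      show "comm_group (add_monoid N Mod ?K)"
        by (rule comm_group.abelian_FactGroup[OF N.M.a_comm_group K])
    next
      fix y m assume "y \<in> carrier ?M" "m \<in> carrier N"
      then show "\<phi> y m \<in> carrier (add_monoid N Mod ?K)"
        using mult_x[of y] \<phi>_mult \<pi>_closed by fastforce
    next
      fix y y' m assume "y \<in> carrier ?M" "y' \<in> carrier ?M" and m: "m \<in> carrier N"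
      then obtain r r' where r: "r \<in> carrier R" "y = r \<otimes> x" "r' \<in> carrier R" "y' = r' \<otimes> x"
        using mult_x by meson
      then have "y \<oplus>\<^bsub>?M\<^esub> y' = (r \<oplus> r') \<otimes> x"
        using x by (simp add: l_distr)
      then have "\<phi> (y \<oplus>\<^bsub>?M\<^esub> y') m = \<pi> ((r \<oplus> r') \<odot>\<^bsub>N\<^esub> m)"
        using \<phi>_mult[of "r \<oplus> r'" m] r m by simp
      then show "\<phi> (y \<oplus>\<^bsub>?M\<^esub> y') m = \<phi> y m \<otimes>\<^bsub>add_monoid N Mod ?K\<^esub> \<phi> y' m"
        using r m \<pi>_add by (simp add: \<phi>_mult N.smult_l_distr)
    next
      fix y m m' assume "y \<in> carrier ?M" and m: "m \<in> carrier N" "m' \<in> carrier N"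
      then obtain r where "r \<in> carrier R" "y = r \<otimes> x"
        using mult_x by meson
      then show "\<phi> y (m \<oplus>\<^bsub>N\<^esub> m') = \<phi> y m \<otimes>\<^bsub>add_monoid N Mod ?K\<^esub> \<phi> y m'"
        using m \<pi>_add by (simp add: \<phi>_mult N.smult_r_distr)
    next
      fix a y m assume a: "a \<in> carrier R" and "y \<in> carrier ?M" and m: "m \<in> carrier N"
      then obtain r where r: "r \<in> carrier R" "y = r \<otimes> x"
        using mult_x by meson
      then have "a \<odot>\<^bsub>?M\<^esub> y = (r \<otimes> a) \<otimes> x"
        using a x by (simp add: m_comm[of r a] m_assoc)
      then show "\<phi> (a \<odot>\<^bsub>?M\<^esub> y) m = \<phi> y (a \<odot>\<^bsub>N\<^esub> m)"
        using \<phi>_mult[of "r \<otimes> a" m] a r m by (simp add: \<phi>_mult N.smult_assoc1)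
    qed blast
    assume "frag_of (x, n) \<in> ?T"
    then have "\<phi> x n = ?K"
      using T h[OF xM n] by (auto simp: kernel_def)
    then have "\<pi> n = ?K"
      using \<phi>_mult[of \<one> n] x n by simp
    then show "n \<in> ?K"
      using group.rcos_self[OF N.M.a_group _ K, of n] n by (simp add: \<pi>_def)
  qed
qed


section \<open>Induced maps on tensor products\<close>

lemma frag_extend_tensor_closed:
  assumes "f \<in> carrier N \<rightarrow> carrier N'" and "Poly_Mapping.keys c \<subseteq> carrier M \<times> carrier N"
  shows "Poly_Mapping.keys (frag_extend (\<lambda>(x, y). frag_of (x, f y)) c) \<subseteq> carrier M \<times> carrier N'"
  using assms by (fastforce dest!: subsetD[OF keys_frag_extend] simp: keys_frag_of split: prod.splits)

lemma frag_extend_tensor_kernel: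
  assumes "module R M" "module R N" "module R N'" and f: "f \<in> module_hom R N N'"
    and c: "c \<in> tensor_kernel R M N"
  shows "frag_extend (\<lambda>(x, y). frag_of (x, f y)) c \<in> tensor_kernel R M N'"
proof -
  interpret src: tensor_factors R M N
    by (intro tensor_factors.intro assms)
  interpret tgt: tensor_factors R M N'
    by (intro tensor_factors.intro assms)
  let ?\<Phi> = "frag_extend (\<lambda>(x, y). frag_of (x, f y))"
  have f_closed: "f \<in> carrier N \<rightarrow> carrier N'"
    and f_add: "\<And>y y'. \<lbrakk>y \<in> carrier N; y' \<in> carrier N\<rbrakk> \<Longrightarrow> f (y \<oplus>\<^bsub>N\<^esub> y') = f y \<oplus>\<^bsub>N'\<^esub> f y'"
    and f_smult: "\<And>r y. \<lbrakk>r \<in> carrier R; y \<in> carrier N\<rbrakk> \<Longrightarrow> f (r \<odot>\<^bsub>N\<^esub> y) = r \<odot>\<^bsub>N'\<^esub> f y"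
    using f by (auto simp: module_hom_def hom_def)
  have "?\<Phi> t \<in> tgt.T" if "t \<in> tensor_relators R M N" for t
    using that f_closed tgt.tensor_add_left tgt.tensor_add_right tgt.tensor_smult
    unfolding tensor_relators_def
    by (auto simp: frag_extend_diff frag_extend_add diff_diff_eq f_add f_smult Pi_def)
  with c show ?thesis
    unfolding tensor_kernel_def[of R M N]
  proof (induction c rule: generate.induct)
    case one
    then show ?case by (simp add: tgt.tensor_kernel_zero)
  next
    case (incl t)
    then show ?case by simp
  next
    case (inv t)
    then show ?case
      using subsetD[OF src.tensor_relators_closed, of t] tgt.tensor_kernel_uminus
      by (simp add: frag_extend_minus)
  next
    case (eng t u)
    then show ?case by (simp add: frag_extend_add tgt.tensor_kernel_add)
  qed
qed

lemma tensor_map_coset: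
  assumes "module R M" "module R N" "module R N'" and f: "f \<in> module_hom R N N'"
    and c: "Poly_Mapping.keys c \<subseteq> carrier M \<times> carrier N"
  shows "tensor_map R M N' f (tensor_kernel R M N #>\<^bsub>free_Abelian_group (carrier M \<times> carrier N)\<^esub> c) =
    tensor_kernel R M N' #>\<^bsub>free_Abelian_group (carrier M \<times> carrier N')\<^esub>
      frag_extend (\<lambda>(x, y). frag_of (x, f y)) c"
proof -
  interpret src: tensor_factors R M N
    by (intro tensor_factors.intro assms)
  interpret tgt: tensor_factors R M N'
    by (intro tensor_factors.intro assms)
  let ?\<Phi> = "frag_extend (\<lambda>(x, y). frag_of (x, f y))"
  have closed: "Poly_Mapping.keys (?\<Phi> d) \<subseteq> carrier M \<times> carrier N'"
    if "Poly_Mapping.keys d \<subseteq> carrier M \<times> carrier N" for d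
    by (rule frag_extend_tensor_closed[OF _ that]) (use f in \<open>simp add: module_hom_def hom_def\<close>)
  have "tgt.T #>\<^bsub>tgt.F\<^esub> ?\<Phi> d = tgt.T #>\<^bsub>tgt.F\<^esub> ?\<Phi> c" if d: "d \<in> src.T #>\<^bsub>src.F\<^esub> c" for d
  proof -
    obtain t where t: "t \<in> src.T" "d = t + c"
      using d by (auto simp: r_coset_def)
    then have "Poly_Mapping.keys d \<subseteq> carrier M \<times> carrier N"
      using src.tensor_kernel_closed[of t] keys_add[of t c] c by blast
    moreover have "?\<Phi> d - ?\<Phi> c \<in> tgt.T"
      using frag_extend_tensor_kernel[OF assms(1-4) t(1)] t(2) by (simp add: frag_extend_add)
    ultimately show ?thesis
      using tgt.tensor_coset_eq_iff closed c by blast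
  qed
  moreover have "c \<in> src.T #>\<^bsub>src.F\<^esub> c"
    using group.rcos_self[OF group_free_Abelian_group _ src.subgroup_tensor_kernel, of c] c by simp
  ultimately show ?thesis
    unfolding tensor_map_def by blast
qed

text \<open>
  Injectivity of \<open>id \<otimes> f\<close> amounts to a trivial kernel, and a trivial kernel can be expressed on
  formal sums. In this form flatness becomes a statement about the vanishing of tensors.
\<close>

lemma inj_tensor_map_iff:
  assumes "module R M" "module R N" "module R N'" and f: "f \<in> module_hom R N N'"
  shows "inj_on (tensor_map R M N' f) (carrier (tensor_product R M N)) \<longleftrightarrow>
    (\<forall>c. Poly_Mapping.keys c \<subseteq> carrier M \<times> carrier N \<longrightarrow>
      frag_extend (\<lambda>(x, y). frag_of (x, f y)) c \<in> tensor_kernel R M N' \<longrightarrow> c \<in> tensor_kernel R M N)"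
    (is "?inj \<longleftrightarrow> ?triv")
proof -
  interpret src: tensor_factors R M N
    by (intro tensor_factors.intro assms)
  interpret tgt: tensor_factors R M N'
    by (intro tensor_factors.intro assms)
  let ?\<Phi> = "frag_extend (\<lambda>(x, y). frag_of (x, f y))"
  have carrier: "carrier (tensor_product R M N) =
      {src.T #>\<^bsub>src.F\<^esub> c | c. Poly_Mapping.keys c \<subseteq> carrier M \<times> carrier N}"
    by (auto simp: tensor_product_def carrier_FactGroup)
  have map_eq: "tensor_map R M N' f (src.T #>\<^bsub>src.F\<^esub> c) = tensor_map R M N' f (src.T #>\<^bsub>src.F\<^esub> d) \<longleftrightarrow>
      ?\<Phi> (c - d) \<in> tgt.T"
    if "Poly_Mapping.keys c \<subseteq> carrier M \<times> carrier N" "Poly_Mapping.keys d \<subseteq> carrier M \<times> carrier N"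
    for c d
  proof -
    have "f \<in> carrier N \<rightarrow> carrier N'"
      using f by (simp add: module_hom_def hom_def)
    then show ?thesis
      using that
      by (simp add: tensor_map_coset[OF assms] frag_extend_diff tgt.tensor_coset_eq_iff
          frag_extend_tensor_closed[where N = N])
  qed
  show ?thesis
  proof
    assume inj: ?inj
    show ?triv
    proof (intro allI impI)
      fix c assume c: "Poly_Mapping.keys c \<subseteq> carrier M \<times> carrier N" "?\<Phi> c \<in> tgt.T"
      have in_carrier: "src.T #>\<^bsub>src.F\<^esub> d \<in> carrier (tensor_product R M N)"
        if "Poly_Mapping.keys d \<subseteq> carrier M \<times> carrier N" for d
        using that unfolding carrier by blast
      have "src.T #>\<^bsub>src.F\<^esub> c = src.T #>\<^bsub>src.F\<^esub> 0"
        by (rule inj_onD[OF inj]) (use c map_eq[of c 0] in_carrier in simp_all)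
      then show "c \<in> src.T"
        using src.tensor_coset_eq_iff[of c 0] c by simp
    qed
  next
    assume triv: ?triv
    show ?inj
    proof (rule inj_onI)
      fix C D
      assume "C \<in> carrier (tensor_product R M N)" "D \<in> carrier (tensor_product R M N)"
        and eq: "tensor_map R M N' f C = tensor_map R M N' f D"
      then obtain c d where c: "Poly_Mapping.keys c \<subseteq> carrier M \<times> carrier N" "C = src.T #>\<^bsub>src.F\<^esub> c"
        and d: "Poly_Mapping.keys d \<subseteq> carrier M \<times> carrier N" "D = src.T #>\<^bsub>src.F\<^esub> d"
        unfolding carrier by blast
      then have "?\<Phi> (c - d) \<in> tgt.T"
        using eq map_eq by blast
      then have "c - d \<in> src.T"
        using triv keys_diff[of c d] c(1) d(1) by blast
      then show "C = D"
        using src.tensor_coset_eq_iff c d by blast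
    qed
  qed
qed

section \<open>Purity of annihilators implies flatness\<close>

text \<open>
  Scalars move to the right-hand factor, \<open>r x \<otimes> m = x \<otimes> r m\<close>, and then sums of tensors with
  the same left-hand factor can be collected.
\<close>

lemma (in cring) tensor_eq_generator_tensor:
  assumes "module R N" and x: "x \<in> carrier R"
    and c: "Poly_Mapping.keys c \<subseteq> carrier (ideal_module R (PIdl x)) \<times> carrier N"
  shows "\<exists>n\<in>carrier N. c - frag_of (x, n) \<in> tensor_kernel R (ideal_module R (PIdl x)) N"
proof -
  let ?M = "ideal_module R (PIdl x)"
  interpret N: module R N by fact
  interpret tensor_factors R ?M N
    by (intro tensor_factors.intro module_ideal_module cgenideal_ideal x \<open>module R N\<close>)
  have xM: "x \<in> carrier ?M"
    by (simp add: cgenideal_self x)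
  show ?thesis
    using c
  proof (induction c rule: frag_induction)
    case zero
    then show ?case
      using tensor_kernel_uminus[OF tensor_zero_right[OF xM]] by auto
  next
    case (diff c d)
    then obtain n n' where n: "n \<in> carrier N" "c - frag_of (x, n) \<in> T"
      and n': "n' \<in> carrier N" "d - frag_of (x, n') \<in> T" by blast
    have "frag_of (x, \<ominus>\<^bsub>N\<^esub> n' \<oplus>\<^bsub>N\<^esub> n) - (frag_of (x, \<ominus>\<^bsub>N\<^esub> n') + frag_of (x, n)) \<in> T"
      using n n' xM by (intro tensor_add_right) auto
    from tensor_kernel_diff[OF tensor_kernel_diff[OF n(2) n'(2)]
        tensor_kernel_add[OF this tensor_minus_right[OF xM n'(1)]]]
    have "c - d - frag_of (x, \<ominus>\<^bsub>N\<^esub> n' \<oplus>\<^bsub>N\<^esub> n) \<in> T"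
      by (simp add: algebra_simps)
    then show ?case
      using n n' by (intro bexI[of _ "\<ominus>\<^bsub>N\<^esub> n' \<oplus>\<^bsub>N\<^esub> n"]) auto
  next
    case (one p)
    then obtain r m where "p = (r \<otimes> x, m)" "r \<in> carrier R" "m \<in> carrier N"
      by (auto simp: cgenideal_def)
    then show ?case
      using tensor_smult[OF _ xM, of r m] by (intro bexI[of _ "r \<odot>\<^bsub>N\<^esub> m"]) auto
  qed
qed

text \<open>
  A generator \<open>a y\<close> of \<open>(0 : x) M\<close> is killed by any \<open>\<alpha> \<in> (0 : a)\<close>, and as \<open>x \<in> (0 : a)\<close>, purity
  supplies such an \<open>\<alpha>\<close> with \<open>\<alpha> x = x\<close>. For a sum, the product of the two scalars kills both
  terms and still fixes \<open>x\<close>.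
\<close>

lemma (in module) ideal_smult_killed_by_local_unit:
  assumes pure: "\<And>s. s \<in> carrier R \<Longrightarrow> pure_ideal R (annihilator R s)"
    and x: "x \<in> carrier R" and n: "n \<in> ideal_smult (annihilator R x) M"
  obtains \<alpha> where "\<alpha> \<in> carrier R" "\<alpha> \<otimes> x = x" "\<alpha> \<odot>\<^bsub>M\<^esub> n = \<zero>\<^bsub>M\<^esub>"
proof -
  let ?K = "{n \<in> carrier M. \<exists>\<alpha>\<in>carrier R. \<alpha> \<otimes> x = x \<and> \<alpha> \<odot>\<^bsub>M\<^esub> n = \<zero>\<^bsub>M\<^esub>}"
  have "ideal_smult (annihilator R x) M \<subseteq> ?K"
  proof (rule ideal_smult_minimal)
    show "subgroup ?K (add_monoid M)"
    proof (rule M.add.subgroupI)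
      show "?K \<noteq> {}"
        using x by (auto intro!: exI[of _ "\<zero>\<^bsub>M\<^esub>"] bexI[of _ \<one>])
    next
      fix n assume "n \<in> ?K"
      then show "\<ominus>\<^bsub>M\<^esub> n \<in> ?K"
        by (auto simp: smult_r_minus)
    next
      fix n m assume "n \<in> ?K" "m \<in> ?K"
      then obtain \<alpha> \<beta> where
        "n \<in> carrier M" "\<alpha> \<in> carrier R" "\<alpha> \<otimes> x = x" "\<alpha> \<odot>\<^bsub>M\<^esub> n = \<zero>\<^bsub>M\<^esub>"
        "m \<in> carrier M" "\<beta> \<in> carrier R" "\<beta> \<otimes> x = x" "\<beta> \<odot>\<^bsub>M\<^esub> m = \<zero>\<^bsub>M\<^esub>" by blast
      moreover from this have "(\<alpha> \<otimes> \<beta>) \<odot>\<^bsub>M\<^esub> n = \<zero>\<^bsub>M\<^esub>" "(\<alpha> \<otimes> \<beta>) \<odot>\<^bsub>M\<^esub> m = \<zero>\<^bsub>M\<^esub>"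
        by (simp add: R.m_comm[of \<alpha> \<beta>] smult_assoc1, simp add: smult_assoc1)
      ultimately show "n \<oplus>\<^bsub>M\<^esub> m \<in> ?K"
        using x by (auto simp: smult_r_distr R.m_assoc intro!: bexI[of _ "\<alpha> \<otimes> \<beta>"])
    qed auto
  next
    fix a y assume a: "a \<in> annihilator R x" and y: "y \<in> carrier M"
    have aR: "a \<in> carrier R" and xa: "x \<in> annihilator R a"
      using a x by (auto simp: annihilator_def R.m_comm)
    obtain \<alpha> where "\<alpha> \<in> annihilator R a" "x = \<alpha> \<otimes> x"
      using pure[OF aR] xa unfolding pure_ideal_def by blast
    then have "\<alpha> \<in> carrier R" "\<alpha> \<otimes> x = x" "\<alpha> \<odot>\<^bsub>M\<^esub> (a \<odot>\<^bsub>M\<^esub> y) = \<zero>\<^bsub>M\<^esub>"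
      using aR y by (auto simp: annihilator_def simp flip: smult_assoc1)
    then show "a \<odot>\<^bsub>M\<^esub> y \<in> ?K"
      using aR y by auto
  qed
  then show thesis using n that by blast
qed

lemma (in cring) flat_principal_ideal_if_pure_annihilators:
  assumes pure: "\<And>s. s \<in> carrier R \<Longrightarrow> pure_ideal R (annihilator R s)" and x: "x \<in> carrier R"
  shows "flat_module TYPE('u) R (ideal_module R (PIdl x))"
  unfolding flat_module_def
proof (intro conjI allI impI)
  let ?M = "ideal_module R (PIdl x)"
  show M: "module R ?M"
    by (rule module_ideal_module[OF cgenideal_ideal[OF x]])
  fix N N' :: "('a, 'u) module" and f
  assume "module R N \<and> module R N' \<and> f \<in> module_hom R N N' \<and> inj_on f (carrier N)"
  then have N: "module R N" and N': "module R N'" and f: "f \<in> module_hom R N N'"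
    and inj: "inj_on f (carrier N)" by auto
  interpret N: module R N by (rule N)
  interpret N': module R N' by (rule N')
  interpret src: tensor_factors R ?M N
    by (intro tensor_factors.intro M N)
  interpret tgt: tensor_factors R ?M N'
    by (intro tensor_factors.intro M N')
  interpret f: group_hom "add_monoid N" "add_monoid N'" f
    using f by (simp add: group_hom_def group_hom_axioms_def module_hom_def N.M.a_group N'.M.a_group)
  have f_smult: "\<And>r y. \<lbrakk>r \<in> carrier R; y \<in> carrier N\<rbrakk> \<Longrightarrow> f (r \<odot>\<^bsub>N\<^esub> y) = r \<odot>\<^bsub>N'\<^esub> f y"
    and f_closed: "\<And>y. y \<in> carrier N \<Longrightarrow> f y \<in> carrier N'"
    using f by (auto simp: module_hom_def hom_def)
  have xM: "x \<in> carrier ?M"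
    by (simp add: cgenideal_self x)
  let ?\<Phi> = "frag_extend (\<lambda>(x, y). frag_of (x, f y))"
  show "inj_on (tensor_map R ?M N' f) (carrier (tensor_product R ?M N))"
    unfolding inj_tensor_map_iff[OF M N N' f]
  proof (intro allI impI)
    fix c assume "Poly_Mapping.keys c \<subseteq> carrier ?M \<times> carrier N" and \<Phi>c: "?\<Phi> c \<in> tgt.T"
    then obtain n where n: "n \<in> carrier N" and cn: "c - frag_of (x, n) \<in> src.T"
      using tensor_eq_generator_tensor[OF N x] by blast
    have "?\<Phi> c - frag_of (x, f n) \<in> tgt.T"
      using frag_extend_tensor_kernel[OF M N N' f cn] by (simp add: frag_extend_diff)
    then have "frag_of (x, f n) \<in> tgt.T"
      using tgt.tensor_kernel_eq \<Phi>c by blast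
    then have "f n \<in> ideal_smult (annihilator R x) N'"
      using tensor_generator_zero_iff[OF N' x] f_closed n by blast
    then obtain \<alpha> where \<alpha>: "\<alpha> \<in> carrier R" "\<alpha> \<otimes> x = x" "\<alpha> \<odot>\<^bsub>N'\<^esub> f n = \<zero>\<^bsub>N'\<^esub>"
      using N'.ideal_smult_killed_by_local_unit[OF pure x] by blast
    then have "f (\<alpha> \<odot>\<^bsub>N\<^esub> n) = f \<zero>\<^bsub>N\<^esub>"
      using n f.hom_one by (simp add: f_smult)
    then have "\<alpha> \<odot>\<^bsub>N\<^esub> n = \<zero>\<^bsub>N\<^esub>"
      using inj_onD[OF inj] \<alpha>(1) n by simp
    then have "frag_of (x, n) - frag_of (x, \<zero>\<^bsub>N\<^esub>) \<in> src.T"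
      using src.tensor_smult[OF \<alpha>(1) xM n] \<alpha>(2) by simp
    then have "frag_of (x, n) \<in> src.T"
      using src.tensor_kernel_eq src.tensor_zero_right[OF xM] by blast
    then show "c \<in> src.T"
      using src.tensor_kernel_eq[OF cn] by blast
  qed
qed

section \<open>Flatness implies purity of annihilators\<close>

text \<open>
  A copy of \<open>M\<close> on the image of an injection \<open>g\<close>. It provides test modules whose elements lie in
  a prescribed type.
\<close>

definition transport_module ::
    "('b \<Rightarrow> 'u) \<Rightarrow> ('a, 'b, 'n) module_scheme \<Rightarrow> ('a, 'u) module" where
  "transport_module g M =
     (let g' = the_inv_into (carrier M) g in
     \<lparr>carrier = g ` carrier M, monoid.mult = \<lambda>u v. g (g' u \<otimes>\<^bsub>M\<^esub> g' v), one = g \<one>\<^bsub>M\<^esub>,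
      ring.zero = g \<zero>\<^bsub>M\<^esub>, ring.add = \<lambda>u v. g (g' u \<oplus>\<^bsub>M\<^esub> g' v),
      smult = \<lambda>r u. g (r \<odot>\<^bsub>M\<^esub> g' u)\<rparr>)"

lemma transport_module_simps:
  shows carrier_transport_module: "carrier (transport_module g M) = g ` carrier M"
    and zero_transport_module: "\<zero>\<^bsub>transport_module g M\<^esub> = g \<zero>\<^bsub>M\<^esub>"
    and add_transport_module: "\<lbrakk>inj_on g (carrier M); x \<in> carrier M; y \<in> carrier M\<rbrakk> \<Longrightarrow>
      g x \<oplus>\<^bsub>transport_module g M\<^esub> g y = g (x \<oplus>\<^bsub>M\<^esub> y)"
    and smult_transport_module: "\<lbrakk>inj_on g (carrier M); x \<in> carrier M\<rbrakk> \<Longrightarrow>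
      r \<odot>\<^bsub>transport_module g M\<^esub> g x = g (r \<odot>\<^bsub>M\<^esub> x)"
  by (simp_all add: transport_module_def Let_def the_inv_into_f_f)

lemma (in module) module_transport_module:
  assumes g: "inj_on g (carrier M)"
  shows "module R (transport_module g M)"
proof (rule moduleI)
  note [simp] = transport_module_simps[where M = M and g = g] g
  show "abelian_group (transport_module g M)"
  proof (rule abelian_groupI)
    fix u assume "u \<in> carrier (transport_module g M)"
    then obtain x where "x \<in> carrier M" "u = g x" by auto
    then show "\<exists>v\<in>carrier (transport_module g M).
        v \<oplus>\<^bsub>transport_module g M\<^esub> u = \<zero>\<^bsub>transport_module g M\<^esub>"
      by (auto simp: M.l_neg intro!: bexI[of _ "\<ominus>\<^bsub>M\<^esub> x"])
  qed (auto simp: M.a_ac)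
qed (auto simp: transport_module_simps g R.is_cring smult_l_distr smult_r_distr smult_assoc1)

text \<open>
  Flatness is tested on (a copy of) the inclusion \<open>R s \<rightarrow> R\<close> and the tensor \<open>x \<otimes> s\<close>. The
  roles of \<open>s\<close> and \<open>x\<close> are exchanged compared with P-flatness: flatness of \<open>R x\<close> produces a
  local unit in \<open>(0 : x)\<close> for \<open>s\<close>, so it yields purity of the annihilator of the generator
  itself.
\<close>

lemma (in cring) pure_annihilator_if_flat:
  assumes flat: "flat_module TYPE('u) R (ideal_module R (PIdl x))" and x: "x \<in> carrier R"
    and universe: "carrier R \<lesssim> (UNIV :: 'u set)"
  shows "pure_ideal R (annihilator R x)"
  unfolding pure_ideal_def
proof
  fix s assume s_ann: "s \<in> annihilator R x"
  then have s: "s \<in> carrier R"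
    by (auto simp: annihilator_def)
  obtain g :: "'a \<Rightarrow> 'u" where g: "inj_on g (carrier R)"
    using universe unfolding lepoll_def by blast
  let ?M = "ideal_module R (PIdl x)"
  let ?N = "transport_module g (ideal_module R (PIdl s))"
  let ?N' = "transport_module g (ideal_module R (carrier R))"
  have sub: "PIdl s \<subseteq> carrier R"
    using s by (auto simp: cgenideal_def)
  then have gs: "inj_on g (PIdl s)"
    using g inj_on_subset by blast
  have M: "module R ?M"
    by (rule module_ideal_module[OF cgenideal_ideal[OF x]])
  have N: "module R ?N"
    by (rule module.module_transport_module[OF module_ideal_module[OF cgenideal_ideal[OF s]]])
      (simp add: gs)
  have N': "module R ?N'"
    by (rule module.module_transport_module[OF module_ideal_module[OF oneideal]]) (simp add: g)
  interpret N: module R ?N by (rule N)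
  interpret N': module R ?N' by (rule N')
  note [simp] = transport_module_simps
  have incl: "(\<lambda>u. u) \<in> module_hom R ?N ?N'"
    using g gs sub by (auto simp: module_hom_def hom_def subset_iff)
  have sN: "s \<in> PIdl s"
    by (rule cgenideal_self[OF s])
  have xM: "x \<in> carrier ?M"
    by (simp add: cgenideal_self x)
  \<comment> \<open>In the copy of \<open>R\<close>, unlike in that of \<open>R s\<close>, the factor \<open>s\<close> can be split off.\<close>
  have "g s = s \<odot>\<^bsub>?N'\<^esub> g \<one>"
    using g s by simp
  then have "g s \<in> ideal_smult (annihilator R x) ?N'"
    using N'.smult_in_ideal_smult[OF s_ann, of "g \<one>"] by simp
  then have "frag_of (x, g s) \<in> tensor_kernel R ?M ?N'"
    using tensor_generator_zero_iff[OF N' x, of "g s"] s by simp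
  moreover have "inj_on (tensor_map R ?M ?N' (\<lambda>u. u)) (carrier (tensor_product R ?M ?N))"
    using flat N N' incl unfolding flat_module_def by (meson inj_onI)
  ultimately have "frag_of (x, g s) \<in> tensor_kernel R ?M ?N"
    unfolding inj_tensor_map_iff[OF M N N' incl]
    using xM sN by (auto simp: keys_frag_of dest!: spec[of _ "frag_of (x, g s)"])
  then have "g s \<in> ideal_smult (annihilator R x) ?N"
    using tensor_generator_zero_iff[OF N x, of "g s"] sN by simp
  moreover have "carrier ?N = {r \<odot>\<^bsub>?N\<^esub> g s | r. r \<in> carrier R}"
    using sN gs by (auto simp: cgenideal_def)
  ultimately obtain a where a: "a \<in> annihilator R x" "g s = a \<odot>\<^bsub>?N\<^esub> g s"
    using N.ideal_smult_cyclic[OF ideal_annihilator[OF x], of "g s" "g s"] sN by auto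
  then have "g s = g (a \<otimes> s)" and "a \<otimes> s \<in> carrier R"
    using gs sN s by (auto simp: annihilator_def)
  then show "\<exists>a\<in>annihilator R x. s = a \<otimes> s"
    using inj_onD[OF g] s a(1) by blast
qed

theorem theorem2p1:
  fixes R :: "('a, 'm) ring_scheme"
  assumes "cring R"
    and universe: "carrier R \<lesssim> (UNIV :: 'u set)"
  shows "((\<forall>I. ideal I R \<longrightarrow> P_flat R (ideal_module R I)) \<longleftrightarrow>
            (\<forall>I. principalideal I R \<longrightarrow> P_flat R (ideal_module R I))) \<and>
         ((\<forall>I. principalideal I R \<longrightarrow> P_flat R (ideal_module R I)) \<longleftrightarrow>
            PF_ring TYPE('u) R) \<and>
         (PF_ring TYPE('u) R \<longleftrightarrow>
            (\<forall>s\<in>carrier R. \<forall>x\<in>carrier R. s \<otimes>\<^bsub>R\<^esub> x = \<zero>\<^bsub>R\<^esub> \<longrightarrow>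
               (\<exists>\<alpha>\<in>annihilator R s. x = \<alpha> \<otimes>\<^bsub>R\<^esub> x)))"
proof -
  interpret cring R by fact
  let ?pure = "\<forall>s\<in>carrier R. pure_ideal R (annihilator R s)"
  have principal_P_flat: "(\<forall>I. principalideal I R \<longrightarrow> P_flat R (ideal_module R I)) \<longleftrightarrow> ?pure"
    using P_flat_ideal_if_pure_annihilators pure_annihilator_if_P_flat principalideal.axioms(1)
    by blast
  have all_P_flat: "(\<forall>I. ideal I R \<longrightarrow> P_flat R (ideal_module R I)) \<longleftrightarrow> ?pure"
    using P_flat_ideal_if_pure_annihilators pure_annihilator_if_P_flat principalideal.axioms(1)
    by blast
  have PF: "PF_ring TYPE('u) R \<longleftrightarrow> ?pure"
  proof
    assume "PF_ring TYPE('u) R"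
    then show ?pure
      using pure_annihilator_if_flat[OF _ _ universe] cgenideal_is_principalideal
      unfolding PF_ring_def by blast
  next
    assume pure: ?pure
    have "flat_module TYPE('u) R (ideal_module R I)" if I: "principalideal I R" for I
    proof -
      obtain x where "x \<in> carrier R" "I = PIdl\<^bsub>R\<^esub> x"
        using principalideal.generate[OF I] cgenideal_eq_genideal by auto
      then show ?thesis
        using flat_principal_ideal_if_pure_annihilators pure by blast
    qed
    then show "PF_ring TYPE('u) R"
      unfolding PF_ring_def using is_cring by blast
  qed
  show ?thesis
    unfolding all_P_flat principal_P_flat PF pure_annihilators_iff by blast
qed

end
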